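(* There is an $\mathsf{n}$-simple model $M$ such that: no $M$-predicate $H$ satisfies $\Phi_M(H)=\mathrm{False}_M$ (F-Tarski holds); no $M$-predicate $H$ satisfies $\Phi_M(H)=\mathrm{True}_M$ (T-Tarski holds); some $M$-predicate $H$ satisfies $\mathrm{False}_M^+=\Phi_M(H)\cap\mathrm{Sent}_M^+$ (F-Tarski$^+$ fails); and some $M$-predicate $H$ satisfies $\mathrm{True}_M^+=\Phi_M(H)\cap\mathrm{Sent}_M^+$ (T-Tarski$^+$ fails).
   Context: For a non-empty set $\Sigma$ of symbols, $\Sigma^\ast$ is the set of all finite strings over $\Sigma$, including the empty string; $XY$ denotes concatenation. Fix distinct symbols $\mathsf{n},\mathsf{r},\sharp$. A simple model is a pair $M=(\Sigma_M,\Phi_M)$ where $\Sigma_M$ is a set of symbols with $\sharp\in\Sigma_M$, and, putting $\mathrm{Pred}_M=\{X\sharp : X\in\Sigma_M^\ast \text{ and } X \text{ does not contain } \sharp\}$, $\Phi_M$ is a function $\mathrm{Pred}_M\to\mathcal{P}(\Sigma_M^\ast)$. Elements of $\mathrm{Pred}_M$ are called $M$-predicates. $\mathrm{Sent}_M=\{HX : H\in\mathrm{Pred}_M, X\in\Sigma_M^\ast\}$ is the set of $M$-sentences (the decomposition $HX$ is unique), and $\mathrm{Sent}_M^+=\mathrm{Sent}_M\setminus\mathrm{Pred}_M$. $\mathrm{True}_M=\{HX\in\mathrm{Sent}_M : H\in\mathrm{Pred}_M, X\in\Phi_M(H)\}$, $\mathrm{True}_M^+=\mathrm{True}_M\cap\mathrm{Sent}_M^+$,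 $\mathrm{False}_M=\mathrm{Sent}_M\setminus\mathrm{True}_M$, $\mathrm{False}_M^+=\mathrm{Sent}_M^+\setminus\mathrm{True}_M^+$. A simple model $M$ is an $\mathsf{n}$-simple model if $\mathsf{n}\in\Sigma_M$ and for each $H\in\mathrm{Pred}_M$ we have $\mathsf{n}H\in\mathrm{Pred}_M$ and $\Phi_M(\mathsf{n}H)=\Sigma_M^\ast\setminus\Phi_M(H)$. *)

theory Defs
  imports "HOL-Library.FuncSet"
begin

text \<open>
  Symbols are the elements of an arbitrary type, strings are lists of symbols, and the set of all
  finite strings over \<open>S\<close> is \<open>lists S\<close>.  The distinguished symbols are parameters.
\<close>

record 'a model =
  Sigma :: "'a set"
  Phi :: "'a list \<Rightarrow> 'a list set"

definition preds :: "'a \<Rightarrow> 'a model \<Rightarrow> 'a list set" where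
  "preds sharp M = {X @ [sharp] | X. X \<in> lists (Sigma M) \<and> sharp \<notin> set X}"

text \<open>
  The extensional function space is used since \<open>Phi M\<close> is a function whose domain is exactly the
  set of predicates; its values at other strings are fixed to be \<open>undefined\<close>.
\<close>

definition simple_model :: "'a \<Rightarrow> 'a model \<Rightarrow> bool" where
  "simple_model sharp M \<longleftrightarrow>
     sharp \<in> Sigma M \<and> Phi M \<in> preds sharp M \<rightarrow>\<^sub>E Pow (lists (Sigma M))"

definition n_simple_model :: "'a \<Rightarrow> 'a \<Rightarrow> 'a model \<Rightarrow> bool" where
  "n_simple_model n sharp M \<longleftrightarrow>
     simple_model sharp M \<and> n \<in> Sigma M \<and>
     (\<forall>H \<in> preds sharp M.
        n # H \<in> preds sharp M \<and> Phi M (n # H) = lists (Sigma M) - Phi M H)"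

definition sents :: "'a \<Rightarrow> 'a model \<Rightarrow> 'a list set" where
  "sents sharp M = {H @ X | H X. H \<in> preds sharp M \<and> X \<in> lists (Sigma M)}"

definition sents_plus :: "'a \<Rightarrow> 'a model \<Rightarrow> 'a list set" where
  "sents_plus sharp M = sents sharp M - preds sharp M"

definition true_sents :: "'a \<Rightarrow> 'a model \<Rightarrow> 'a list set" where
  "true_sents sharp M =
     {H @ X | H X. H @ X \<in> sents sharp M \<and> H \<in> preds sharp M \<and> X \<in> Phi M H}"

definition true_sents_plus :: "'a \<Rightarrow> 'a model \<Rightarrow> 'a list set" where
  "true_sents_plus sharp M = true_sents sharp M \<inter> sents_plus sharp M"

definition false_sents :: "'a \<Rightarrow> 'a model \<Rightarrow> 'a list set" where
  "false_sents sharp M = sents sharp M - true_sents sharp M"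

definition false_sents_plus :: "'a \<Rightarrow> 'a model \<Rightarrow> 'a list set" where
  "false_sents_plus sharp M = sents_plus sharp M - true_sents_plus sharp M"

end

theory Submission
  imports Defs
begin

text \<open>
  Over the full alphabet, let \<open>X\<close> satisfy \<open>H\<close> iff \<open>H @ X\<close> contains an odd number of \<open>n\<close>.
  Prefixing \<open>n\<close> to a predicate flips the parity, hence acts as negation, and a sentence is true iff
  it contains an odd number of \<open>n\<close>.  So on sentences \<open>[sharp]\<close> expresses truth and \<open>[n, sharp]\<close>
  expresses falsity.  But every predicate holds of one of \<open>[]\<close> and \<open>[n]\<close>, neither of which
  is a sentence, so no predicate has exactly the true or exactly the false sentences as extension.
\<close>

text \<open>The domain is spelled out because \<open>preds\<close> takes the model being defined as
  an argument; the restricted lambda gives \<open>undefined\<close> outside it.\<close>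

definition parity_model :: "'a \<Rightarrow> 'a \<Rightarrow> 'a model" where
  "parity_model n sharp =
     \<lparr>Sigma = UNIV,
      Phi = (\<lambda>H \<in> {X @ [sharp] | X. sharp \<notin> set X}. {X. odd (count_list (H @ X) n)})\<rparr>"

lemma Sigma_parity_model [simp]: "Sigma (parity_model n sharp) = UNIV"
  by (simp add: parity_model_def)

lemma preds_parity_model:
  "preds sharp (parity_model n sharp) = {X @ [sharp] | X. sharp \<notin> set X}"
  by (simp add: preds_def)

lemma Phi_parity_model:
  "Phi (parity_model n sharp) =
     (\<lambda>H \<in> preds sharp (parity_model n sharp). {X. odd (count_list (H @ X) n)})"
  unfolding preds_parity_model by (simp add: parity_model_def)

text \<open>Membership of \<open>X\<close> in the extension of \<open>H\<close> depends only on
  \<open>H @ X\<close>, so how a sentence is split does not matter.\<close>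

lemma true_sents_parity_model:
  "true_sents sharp (parity_model n sharp) =
     {S \<in> sents sharp (parity_model n sharp). odd (count_list S n)}"
  by (auto simp: true_sents_def sents_def Phi_parity_model simp del: count_list_append)

lemma sharp_in_sents: "S \<in> sents sharp M \<Longrightarrow> sharp \<in> set S"
  by (auto simp: sents_def preds_def)

lemma Cons_in_preds_parity_model:
  assumes "n \<noteq> sharp" and "H \<in> preds sharp (parity_model n sharp)"
  shows "n # H \<in> preds sharp (parity_model n sharp)"
proof -
  obtain X where "H = X @ [sharp]" "sharp \<notin> set X"
    using assms(2) by (auto simp: preds_parity_model)
  then have "n # H = (n # X) @ [sharp]" "sharp \<notin> set (n # X)"
    using assms(1) by auto
  then show ?thesis
    unfolding preds_parity_model by blast
qed

lemma n_simple_model_parity_model: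
  assumes "n \<noteq> sharp"
  shows "n_simple_model n sharp (parity_model n sharp)"
  using Cons_in_preds_parity_model[OF assms]
  by (auto simp: n_simple_model_def simple_model_def Phi_parity_model)

lemma Phi_parity_model_not_subset_sents:
  assumes "n \<noteq> sharp" and "H \<in> preds sharp (parity_model n sharp)"
  shows "\<not> Phi (parity_model n sharp) H \<subseteq> sents sharp (parity_model n sharp)"
proof -
  \<comment> \<open>Appending \<open>n\<close> to \<open>H\<close> raises the count of
    \<open>n\<close> by one, so one of the two counts is odd.\<close>
  have "[] \<in> Phi (parity_model n sharp) H \<or> [n] \<in> Phi (parity_model n sharp) H"
    using assms(2) by (simp add: Phi_parity_model)
  then show ?thesis
    using assms(1) sharp_in_sents by fastforce
qed

theorem proposition4p6:
  fixes n r sharp :: 'a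
  assumes "distinct [n, r, sharp]"
  shows "\<exists>M :: 'a model.
    n_simple_model n sharp M \<and>
    \<not> (\<exists>H \<in> preds sharp M. Phi M H = false_sents sharp M) \<and>
    \<not> (\<exists>H \<in> preds sharp M. Phi M H = true_sents sharp M) \<and>
    (\<exists>H \<in> preds sharp M. false_sents_plus sharp M = Phi M H \<inter> sents_plus sharp M) \<and>
    (\<exists>H \<in> preds sharp M. true_sents_plus sharp M = Phi M H \<inter> sents_plus sharp M)"
proof -
  let ?M = "parity_model n sharp"
  have ne: "n \<noteq> sharp"
    using assms by auto
  have T: "[sharp] \<in> preds sharp ?M"
    by (simp add: preds_parity_model)
  have F: "[n, sharp] \<in> preds sharp ?M"
    using Cons_in_preds_parity_model[OF ne T] .
  have "false_sents sharp ?M \<subseteq> sents sharp ?M" "true_sents sharp ?M \<subseteq> sents sharp ?M"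
    by (auto simp: false_sents_def true_sents_parity_model)
  then have "\<forall>H \<in> preds sharp ?M. Phi ?M H \<noteq> false_sents sharp ?M \<and> Phi ?M H \<noteq> true_sents sharp ?M"
    using Phi_parity_model_not_subset_sents[OF ne] by metis
  \<comment> \<open>As \<open>n \<noteq> sharp\<close>, prefixing \<open>[sharp]\<close> keeps the
    parity of a sentence, while \<open>[n, sharp]\<close> below flips it.\<close>
  moreover have true: "true_sents_plus sharp ?M = Phi ?M [sharp] \<inter> sents_plus sharp ?M"
    using T ne by (auto simp: true_sents_plus_def sents_plus_def true_sents_parity_model Phi_parity_model)
  moreover have "false_sents_plus sharp ?M = Phi ?M [n, sharp] \<inter> sents_plus sharp ?M"
    unfolding false_sents_plus_def true using T F ne by (auto simp: Phi_parity_model)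
  ultimately show ?thesis
    using n_simple_model_parity_model[OF ne] T F by blast
qed

end
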